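(* Let $\mathbf{A}\in\mathbb{R}^{n\times d}$ be such that $\mathbf{M}:=\mathbf{A}^T\mathbf{A}$ is positive definite, let $d=cs$ with positive integers $c,s$, and let $\{\mathcal{P}_1,\dots,\mathcal{P}_c\}$ be a partition of $\{1,\dots,d\}$ into $c$ sets of cardinality $s$. Let $\sigma',\sigma,\omega',\omega$ be the quantities defined in the context. Then $$\max\left\{1,\frac{\sigma}{s}\right\}\le\sigma'\le\omega'\le c,\qquad 1\le\sigma\le\omega\le d.$$
   Context: Let $D^{\mathbf{M}}$ be the diagonal matrix with the same diagonal as $\mathbf{M}$, and $\mathbf{Q}:=(D^{\mathbf{M}})^{-1/2}\mathbf{M}(D^{\mathbf{M}})^{-1/2}$. Let $B^{\mathbf{Q}}\in\mathbb{R}^{d\times d}$ be the block diagonal of $\mathbf{Q}$ associated with the partition: $B^{\mathbf{Q}}_{ij}=\mathbf{Q}_{ij}$ if $i,j\in\mathcal{P}_l$ for some $l$, and $B^{\mathbf{Q}}_{ij}=0$ otherwise. Define $$\sigma':=\max\{x^T\mathbf{Q}x : x\in\mathbb{R}^d,\ x^TB^{\mathbf{Q}}x\le1\},\qquad \sigma:=\max\{x^T\mathbf{Q}x : x\in\mathbb{R}^d,\ x^Tx\le1\}.$$ For each $l\in\{1,\dots,c\}$ let $\mathbf{A}_l\in\mathbb{R}^{n\times s}$ be the column submatrix of $\mathbf{A}$ corresponding to the columns $i\in\mathcal{P}_l$, and let $a_{rl}$ be the $r$-th row of $\mathbf{A}_l$. Define $$\omega':=\max_{1\le r\le n}|\{l\in\{1,\dots,c\}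 : a_{rl}\ne0\}|,\qquad \omega:=\max_{1\le r\le n}|\{l\in\{1,\dots,d\} : \mathbf{A}_{rl}\ne0\}|,$$ i.e. $\omega'$ is the maximum over rows $r$ of the number of matrices $\mathbf{A}_l$ with a nonzero in row $r$, and $\omega$ is the maximum number of nonzeros in a row of $\mathbf{A}$. *)

theory Defs
  imports "HOL-Analysis.Analysis"
begin

definition positive_definite :: "real ^ 'd ^ 'd \<Rightarrow> bool" where
  "positive_definite M \<longleftrightarrow>
     transpose M = M \<and> (\<forall>x. x \<noteq> 0 \<longrightarrow> x \<bullet> (M *v x) > 0)"

definition diagonal_part :: "real ^ 'd ^ 'd \<Rightarrow> real ^ 'd ^ 'd" where
  "diagonal_part M = (\<chi> i j. if i = j then M $ i $ j else 0)"

text \<open>Real power of a diagonal matrix with positive diagonal; off-diagonal entries of the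
  argument are ignored.\<close>

definition diagonal_powr :: "real ^ 'd ^ 'd \<Rightarrow> real \<Rightarrow> real ^ 'd ^ 'd" where
  "diagonal_powr D p = (\<chi> i j. if i = j then (D $ i $ i) powr p else 0)"

definition diagonal_normalization :: "real ^ 'd ^ 'd \<Rightarrow> real ^ 'd ^ 'd" where
  "diagonal_normalization M =
     diagonal_powr (diagonal_part M) (- 1 / 2) ** M ** diagonal_powr (diagonal_part M) (- 1 / 2)"

text \<open>In the following, the blocks are \<open>P 1, \<dots>, P c\<close>.\<close>

definition block_diagonal :: "nat \<Rightarrow> (nat \<Rightarrow> 'd set) \<Rightarrow> real ^ 'd ^ 'd \<Rightarrow> real ^ 'd ^ 'd" where
  "block_diagonal c P Q =
     (\<chi> i j. if \<exists>l\<in>{1..c}. i \<in> P l \<and> j \<in> P l then Q $ i $ j else 0)"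

text \<open>Both constants are genuine maxima, not suprema: nothing can be derived about a
  \<open>GREATEST\<close> term before an attained upper bound has been exhibited.\<close>

definition sigma_block :: "nat \<Rightarrow> (nat \<Rightarrow> 'd set) \<Rightarrow> real ^ 'd ^ 'd \<Rightarrow> real" where
  "sigma_block c P Q =
     (GREATEST v. v \<in> {x \<bullet> (Q *v x) | x. x \<bullet> (block_diagonal c P Q *v x) \<le> 1})"

definition sigma_coord :: "real ^ 'd ^ 'd \<Rightarrow> real" where
  "sigma_coord Q = (GREATEST v. v \<in> {x \<bullet> (Q *v x) | x. x \<bullet> x \<le> 1})"

text \<open>The submatrix of \<open>A\<close> with columns in \<open>S\<close> is represented with the index type of
  \<open>A\<close>, the columns outside \<open>S\<close> being padded with zeros; this does not affect which of
  its rows vanish.\<close>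

definition column_submatrix :: "real ^ 'd ^ 'n \<Rightarrow> 'd set \<Rightarrow> real ^ 'd ^ 'n" where
  "column_submatrix A S = (\<chi> r j. if j \<in> S then A $ r $ j else 0)"

definition omega_block :: "nat \<Rightarrow> (nat \<Rightarrow> 'd set) \<Rightarrow> real ^ 'd ^ 'n \<Rightarrow> nat" where
  "omega_block c P A =
     Max (range (\<lambda>r. card {l \<in> {1..c}. row r (column_submatrix A (P l)) \<noteq> 0}))"

definition omega_coord :: "real ^ 'd ^ 'n \<Rightarrow> nat" where
  "omega_coord A = Max (range (\<lambda>r. card {j. A $ r $ j \<noteq> 0}))"

end

theory Submission
  imports Defs
begin

text \<open>Normalising the columns of \<open>A\<close> to unit length gives a matrix \<open>C\<close> with the same zero pattern
  and \<open>Q = C\<^sup>T C\<close>, so \<open>x\<^sup>T Q x = \<parallel>C x\<parallel>\<^sup>2\<close> and \<open>x\<^sup>T B x = (\<Sum>l. \<parallel>C\<^sub>l x\<parallel>\<^sup>2)\<close>. Every upper bound is then the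
  Cauchy--Schwarz inequality applied in each row to the sum over those blocks that do not vanish
  there: for the blocks \<open>P l\<close> it gives \<open>\<sigma>' \<le> \<omega>'\<close>, for singletons \<open>\<sigma> \<le> \<omega>\<close>, and for singletons inside
  one block \<open>\<parallel>C\<^sub>l x\<parallel>\<^sup>2 \<le> s \<parallel>x\<^sub>l\<parallel>\<^sup>2\<close>, whence \<open>\<sigma> \<le> s \<sigma>'\<close>. The lower bounds by 1 come from unit vectors.\<close>

section \<open>Gram matrices and Cauchy-Schwarz row by row\<close>

lemma inner_gram_matrix:
  fixes C :: "real ^ 'd ^ 'n"
  shows "x \<bullet> ((transpose C ** C) *v x) = (norm (C *v x))\<^sup>2"
  by (simp add: matrix_vector_mul_assoc [symmetric] power2_norm_eq_inner
      dot_lmul_matrix [symmetric] vector_transpose_matrix inner_commute)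

text \<open>Zero terms drop out of both sums, so Cauchy-Schwarz against the constant 1 is needed
  only on the support. The factor is then the number of nonzero terms instead of
  \<open>card L\<close>; this is how the quantities \<omega>' and \<omega> enter.\<close>

lemma sum_squared_le_card_support:
  fixes f :: "'a \<Rightarrow> real"
  assumes "finite L"
  shows "(\<Sum>l\<in>L. f l)\<^sup>2 \<le> real (card {l \<in> L. f l \<noteq> 0}) * (\<Sum>l\<in>L. (f l)\<^sup>2)"
proof -
  let ?S = "{l \<in> L. f l \<noteq> 0}"
  have "(\<Sum>l\<in>L. f l) = (\<Sum>l\<in>?S. f l)" and "(\<Sum>l\<in>L. (f l)\<^sup>2) = (\<Sum>l\<in>?S. (f l)\<^sup>2)"
    by (rule sum.mono_neutral_right; use assms in auto)+
  then show ?thesis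
    using sum_squared_le_sum_of_squares [of f ?S] by (simp add: mult.commute)
qed

lemma column_submatrix_mult_nth:
  "(column_submatrix C S *v x) $ r = (\<Sum>j\<in>S. C $ r $ j * x $ j)"
  by (simp add: matrix_vector_mult_def column_submatrix_def if_distrib [of "\<lambda>a. a * _"]
      sum.If_cases cong: if_cong)

lemma row_column_submatrix_eq_0_iff:
  "row r (column_submatrix C S) = 0 \<longleftrightarrow> (\<forall>j\<in>S. C $ r $ j = 0)"
  by (auto simp: row_def column_submatrix_def vec_eq_iff)

lemma column_submatrix_UNIV [simp]: "column_submatrix C UNIV = C"
  by (simp add: column_submatrix_def vec_eq_iff)

lemma power2_norm_vec: "(norm (v :: real ^ 'n))\<^sup>2 = (\<Sum>r\<in>UNIV. (v $ r)\<^sup>2)"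
  unfolding power2_norm_eq_inner inner_vec_def by (simp add: power2_eq_square)

lemma norm_column_submatrix_singleton:
  fixes C :: "real ^ 'd ^ 'n"
  shows "(norm (column_submatrix C {j} *v x))\<^sup>2 = (norm (column j C))\<^sup>2 * (x $ j)\<^sup>2"
  by (simp add: power2_norm_vec column_submatrix_mult_nth column_def power_mult_distrib
      sum_distrib_right)

text \<open>By disjointness, each entry of the product for the union is the sum of the entries for
  the blocks. In row \<open>r\<close> at most \<open>w\<close> of these are nonzero, and the bounds
  are then added over all rows. The family \<open>P\<close> is arbitrary so that both the given
  partition and singletons fit.\<close>

lemma norm_column_submatrix_le:
  fixes C :: "real ^ 'd ^ 'n"
  assumes "finite L" and disj: "disjoint_family_on P L"
    and w: "\<And>r. card {l \<in> L. row r (column_submatrix C (P l)) \<noteq> 0} \<le> w"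
  shows "(norm (column_submatrix C (\<Union>l\<in>L. P l) *v x))\<^sup>2
    \<le> real w * (\<Sum>l\<in>L. (norm (column_submatrix C (P l) *v x))\<^sup>2)"
proof -
  let ?y = "\<lambda>l. column_submatrix C (P l) *v x"
  have "((column_submatrix C (\<Union>l\<in>L. P l) *v x) $ r)\<^sup>2 \<le> real w * (\<Sum>l\<in>L. (?y l $ r)\<^sup>2)" for r
  proof -
    have "(column_submatrix C (\<Union>l\<in>L. P l) *v x) $ r = (\<Sum>l\<in>L. ?y l $ r)"
      using disj \<open>finite L\<close>
      by (auto simp: column_submatrix_mult_nth disjoint_family_on_def intro!: sum.UNION_disjoint)
    then have "((column_submatrix C (\<Union>l\<in>L. P l) *v x) $ r)\<^sup>2
        \<le> real (card {l \<in> L. ?y l $ r \<noteq> 0}) * (\<Sum>l\<in>L. (?y l $ r)\<^sup>2)"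
      using sum_squared_le_card_support [OF \<open>finite L\<close>] by metis
    moreover have "card {l \<in> L. ?y l $ r \<noteq> 0} \<le> card {l \<in> L. row r (column_submatrix C (P l)) \<noteq> 0}"
    proof (rule card_mono)
      have "?y l $ r = 0" if "row r (column_submatrix C (P l)) = 0" for l
        using that by (simp add: row_column_submatrix_eq_0_iff column_submatrix_mult_nth)
      then show "{l \<in> L. ?y l $ r \<noteq> 0} \<subseteq> {l \<in> L. row r (column_submatrix C (P l)) \<noteq> 0}"
        by blast
    qed (use \<open>finite L\<close> in simp)
    ultimately show ?thesis
      using w [of r] by (meson le_trans mult_right_mono of_nat_mono order_trans sum_nonneg zero_le_power2)
  qed
  then have "(norm (column_submatrix C (\<Union>l\<in>L. P l) *v x))\<^sup>2
      \<le> (\<Sum>r\<in>UNIV. real w * (\<Sum>l\<in>L. (?y l $ r)\<^sup>2))"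
    unfolding power2_norm_vec by (rule sum_mono)
  also have "\<dots> = real w * (\<Sum>l\<in>L. (norm (?y l))\<^sup>2)"
    unfolding power2_norm_vec sum_distrib_left by (rule sum.swap)
  finally show ?thesis .
qed

lemma sum_matrix_vector_mult:
  fixes F :: "'l \<Rightarrow> real ^ 'd ^ 'n"
  shows "(\<Sum>l\<in>L. F l) *v x = (\<Sum>l\<in>L. F l *v x)"
  by (induction L rule: infinite_finite_induct) (simp_all add: matrix_vector_mult_add_rdistrib)

text \<open>Padding with zeros confines the Gram matrix of the block \<open>P l\<close> to the
  positions in \<open>P l \<times> P l\<close>. Disjointness keeps these positions apart for
  different \<open>l\<close>, so the matrices add up to the block diagonal without overlap.\<close>

lemma block_diagonal_gram_matrix:
  fixes C :: "real ^ 'd ^ 'n"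
  assumes disj: "disjoint_family_on P {1..c}"
  shows "x \<bullet> (block_diagonal c P (transpose C ** C) *v x)
    = (\<Sum>l\<in>{1..c}. (norm (column_submatrix C (P l) *v x))\<^sup>2)"
proof -
  let ?G = "\<lambda>l. transpose (column_submatrix C (P l)) ** column_submatrix C (P l)"
  have G: "?G l $ i $ j = (if i \<in> P l \<and> j \<in> P l then (transpose C ** C) $ i $ j else 0)" for l i j
    by (auto simp: matrix_matrix_mult_def transpose_def column_submatrix_def)
  have "block_diagonal c P (transpose C ** C) = (\<Sum>l\<in>{1..c}. ?G l)"
  proof -
    have "block_diagonal c P (transpose C ** C) $ i $ j = (\<Sum>l\<in>{1..c}. ?G l $ i $ j)" for i j
    proof (cases "\<exists>l\<in>{1..c}. i \<in> P l \<and> j \<in> P l")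
      case True
      then obtain k where k: "k \<in> {1..c}" "i \<in> P k" "j \<in> P k" by blast
      have "i \<in> P l \<and> j \<in> P l \<longleftrightarrow> l = k" if "l \<in> {1..c}" for l
        using k that disj by (metis IntI disjoint_family_on_def empty_iff)
      then have "(\<Sum>l\<in>{1..c}. ?G l $ i $ j)
          = (\<Sum>l\<in>{1..c}. if l = k then (transpose C ** C) $ i $ j else 0)"
        unfolding G by (intro sum.cong) auto
      with k True show ?thesis by (simp add: block_diagonal_def)
    next
      case False
      then show ?thesis unfolding G
        by (subst sum.neutral) (auto simp: block_diagonal_def)
    qed
    then show ?thesis by (simp add: vec_eq_iff)
  qed
  then have "x \<bullet> (block_diagonal c P (transpose C ** C) *v x) = (\<Sum>l\<in>{1..c}. x \<bullet> (?G l *v x))"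
    by (simp add: sum_matrix_vector_mult inner_sum_right)
  then show ?thesis by (simp only: inner_gram_matrix)
qed

section \<open>Attainment of the maxima\<close>

lemma compact_quadratic_sublevel:
  fixes B :: "real ^ 'd ^ 'd"
  assumes pos: "\<And>x. x \<noteq> 0 \<Longrightarrow> x \<bullet> (B *v x) > 0"
  shows "compact {x. x \<bullet> (B *v x) \<le> 1}"
proof -
  have cont: "continuous_on S (\<lambda>x. x \<bullet> (B *v x))" for S
    by (intro continuous_intros linear_continuous_on matrix_vector_mul_bounded_linear)
  have "sphere (0 :: real ^ 'd) 1 \<noteq> {}" by simp
  then obtain u :: "real ^ 'd" where u: "norm u = 1"
    and min: "\<And>y. norm y = 1 \<Longrightarrow> u \<bullet> (B *v u) \<le> y \<bullet> (B *v y)"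
    using continuous_attains_inf [OF compact_sphere _ cont, of 0 1] by (auto simp: dist_norm)
  let ?m = "u \<bullet> (B *v u)"
  have m: "?m > 0" using u pos [of u] by force
  \<comment> \<open>Coercivity: the positive minimum \<open>?m\<close> over the unit sphere extends
    to all vectors because the form is homogeneous of degree 2. It bounds the sublevel set.\<close>
  have lower: "?m * (norm x)\<^sup>2 \<le> x \<bullet> (B *v x)" for x
  proof (cases "x = 0")
    case False
    have "?m \<le> (x /\<^sub>R norm x) \<bullet> (B *v (x /\<^sub>R norm x))"
      by (rule min) (use False in simp)
    also have "\<dots> = (x \<bullet> (B *v x)) / (norm x)\<^sup>2"
      by (simp add: matrix_vector_mult_scaleR power2_eq_square divide_simps)
    finally show ?thesis using False by (simp add: field_simps)
  qed simp
  have "bounded {x. x \<bullet> (B *v x) \<le> 1}"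
    unfolding bounded_iff
  proof (intro exI ballI)
    fix x assume "x \<in> {x. x \<bullet> (B *v x) \<le> 1}"
    then have "?m * (norm x)\<^sup>2 \<le> 1" using lower [of x] by simp
    then have "(norm x)\<^sup>2 \<le> 1 / ?m" using m by (simp add: field_simps)
    then show "norm x \<le> sqrt (1 / ?m)" by (rule real_le_rsqrt)
  qed
  moreover have "closed {x. x \<bullet> (B *v x) \<le> 1}"
    by (rule closed_Collect_le [OF cont]) simp
  ultimately show ?thesis by (simp add: compact_eq_bounded_closed)
qed

text \<open>Compactness of the constraint set turns \<open>GREATEST\<close> into an attained
  maximum. Rescaling then replaces the constraint by a homogeneous inequality, which can be applied
  to vectors that violate the constraint.\<close>

lemma Greatest_quadratic_form:
  fixes B Q :: "real ^ 'd ^ 'd"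
  defines "m \<equiv> (GREATEST v. v \<in> {x \<bullet> (Q *v x) | x. x \<bullet> (B *v x) \<le> 1})"
  assumes pos: "\<And>x. x \<noteq> 0 \<Longrightarrow> x \<bullet> (B *v x) > 0"
  obtains x where "x \<bullet> (B *v x) \<le> 1" "x \<bullet> (Q *v x) = m"
    "\<And>y. y \<bullet> (Q *v y) \<le> m * (y \<bullet> (B *v y))"
proof -
  let ?K = "{x. x \<bullet> (B *v x) \<le> 1}"
  have cont: "continuous_on ?K (\<lambda>x. x \<bullet> (Q *v x))"
    by (intro continuous_intros linear_continuous_on matrix_vector_mul_bounded_linear)
  have "0 \<in> ?K" by simp
  then obtain x where x: "x \<in> ?K" and max: "\<And>y. y \<in> ?K \<Longrightarrow> y \<bullet> (Q *v y) \<le> x \<bullet> (Q *v x)"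
    using continuous_attains_sup [OF compact_quadratic_sublevel [OF pos] _ cont] by blast
  have m: "m = x \<bullet> (Q *v x)"
    unfolding m_def by (rule Greatest_equality) (use x max in auto)
  have "y \<bullet> (Q *v y) \<le> m * (y \<bullet> (B *v y))" for y
  proof (cases "y = 0")
    case False
    define b where "b = y \<bullet> (B *v y)"
    have b: "b > 0" using pos [OF False] by (simp add: b_def)
    have scale: "(y /\<^sub>R sqrt b) \<bullet> (N *v (y /\<^sub>R sqrt b)) = (y \<bullet> (N *v y)) / b" for N :: "real ^ 'd ^ 'd"
      using b by (simp add: matrix_vector_mult_scaleR divide_simps)
    have "y /\<^sub>R sqrt b \<in> ?K"
      unfolding mem_Collect_eq scale using b by (simp add: b_def)
    from max [OF this] have "(y \<bullet> (Q *v y)) / b \<le> m" unfolding scale m .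
    then show ?thesis using b by (simp add: b_def field_simps)
  qed simp
  with x m that show ?thesis by auto
qed

section \<open>Diagonal scaling\<close>

lemma transpose_diagonal_powr [simp]: "transpose (diagonal_powr D p) = diagonal_powr D p"
  by (auto simp: transpose_def diagonal_powr_def vec_eq_iff)

lemma mult_diagonal_powr_nth:
  "(A ** diagonal_powr D p) $ r $ j = A $ r $ j * (D $ j $ j) powr p"
  by (simp add: matrix_matrix_mult_def diagonal_powr_def if_distrib [of "\<lambda>a. _ * a"] cong: if_cong)

lemma gram_matrix_diagonal_nth: "(transpose A ** A) $ j $ j = (norm (column j (A :: real ^ 'd ^ 'n)))\<^sup>2"
  unfolding power2_norm_vec
  by (simp add: matrix_matrix_mult_def transpose_def column_def power2_eq_square)

theorem lemma1:
  fixes A :: "real ^ 'd ^ 'n" and M Q :: "real ^ 'd ^ 'd"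
    and P :: "nat \<Rightarrow> 'd set" and c s :: nat
  assumes M: "M = transpose A ** A"
    and pd: "positive_definite M"
    and Q: "Q = diagonal_normalization M"
    and c_pos: "c > 0" and s_pos: "s > 0"
    and d: "CARD('d) = c * s"
    and disj: "disjoint_family_on P {1..c}"
    and cover: "(\<Union>l\<in>{1..c}. P l) = UNIV"
    and block_card: "\<And>l. l \<in> {1..c} \<Longrightarrow> card (P l) = s"
  shows "max 1 (sigma_coord Q / real s) \<le> sigma_block c P Q
       \<and> sigma_block c P Q \<le> real (omega_block c P A)
       \<and> omega_block c P A \<le> c
       \<and> 1 \<le> sigma_coord Q
       \<and> sigma_coord Q \<le> real (omega_coord A)
       \<and> omega_coord A \<le> CARD('d)"
proof -
  define C where "C = A ** diagonal_powr (diagonal_part M) (- 1 / 2)"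
  define B where "B = block_diagonal c P Q"
  have Q_gram: "Q = transpose C ** C"
    by (simp add: Q C_def M diagonal_normalization_def matrix_transpose_mul matrix_mul_assoc)
  have quad: "x \<bullet> (Q *v x) = (norm (C *v x))\<^sup>2" for x
    by (simp add: Q_gram inner_gram_matrix)
  have block_quad: "x \<bullet> (B *v x) = (\<Sum>l\<in>{1..c}. (norm (column_submatrix C (P l) *v x))\<^sup>2)" for x
    unfolding B_def Q_gram by (rule block_diagonal_gram_matrix [OF disj])

  have M_pos: "M $ j $ j > 0" for j
  proof -
    have "axis j 1 \<bullet> (M *v axis j 1) > 0"
      using pd by (simp add: positive_definite_def axis_eq_0_iff)
    then show ?thesis
      by (simp add: matrix_vector_mult_basis inner_axis' column_def)
  qed
  have C_nth: "C $ r $ j = A $ r $ j * (M $ j $ j) powr (- 1 / 2)" for r j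
    by (simp add: C_def mult_diagonal_powr_nth diagonal_part_def)
  \<comment> \<open>Each column is multiplied by a positive factor, so the nonzero counts defined
    from \<open>A\<close> also bound those of \<open>C\<close>.\<close>
  have C_eq_0_iff: "C $ r $ j = 0 \<longleftrightarrow> A $ r $ j = 0" for r j
    using M_pos [of j] by (simp add: C_nth)
  \<comment> \<open>The squared factor is the inverse of \<open>M $ j $ j\<close>, which is itself
    the squared norm of column \<open>j\<close> of \<open>A\<close>.\<close>
  have unit: "(norm (column j C))\<^sup>2 = 1" for j
  proof -
    have "column j C = (M $ j $ j) powr (- 1 / 2) *\<^sub>R column j A"
      by (simp add: vec_eq_iff column_def C_nth)
    then have "(norm (column j C))\<^sup>2 = ((M $ j $ j) powr (- 1 / 2))\<^sup>2 * M $ j $ j"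
      by (simp add: power_mult_distrib M gram_matrix_diagonal_nth)
    also have "((M $ j $ j) powr (- 1 / 2))\<^sup>2 = (M $ j $ j) powr (- 1)"
      using M_pos [of j] by (simp add: power2_eq_square powr_add [symmetric])
    finally show ?thesis using M_pos [of j] by (simp add: powr_minus)
  qed

  \<comment> \<open>Inequalities between the quadratic forms\<close>
  have block_le: "x \<bullet> (Q *v x) \<le> real (omega_block c P A) * (x \<bullet> (B *v x))" for x
  proof -
    have "(norm (column_submatrix C (\<Union>l\<in>{1..c}. P l) *v x))\<^sup>2
      \<le> real (omega_block c P A) * (\<Sum>l\<in>{1..c}. (norm (column_submatrix C (P l) *v x))\<^sup>2)"
      by (rule norm_column_submatrix_le [OF _ disj])
        (simp_all add: omega_block_def row_column_submatrix_eq_0_iff C_eq_0_iff)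
    then show ?thesis by (simp only: quad block_quad cover column_submatrix_UNIV)
  qed
  \<comment> \<open>Singletons are the blocks here, and unit columns reduce each block term to
    \<open>(x $ j)^2\<close>. The case \<open>S = UNIV\<close> compares \<open>Q\<close> with the
    identity, the case \<open>S = P l\<close> compares \<open>B\<close> with it.\<close>
  have coord_le: "(norm (column_submatrix C S *v x))\<^sup>2 \<le> real w * (\<Sum>j\<in>S. (x $ j)\<^sup>2)"
    if "\<And>r. card {j \<in> S. A $ r $ j \<noteq> 0} \<le> w" for S w x
  proof -
    have "(norm (column_submatrix C (\<Union>j\<in>S. {j}) *v x))\<^sup>2
      \<le> real w * (\<Sum>j\<in>S. (norm (column_submatrix C {j} *v x))\<^sup>2)"
      by (rule norm_column_submatrix_le)
        (simp_all add: that disjoint_family_on_def row_column_submatrix_eq_0_iff C_eq_0_iff)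
    then show ?thesis by (simp add: norm_column_submatrix_singleton unit)
  qed
  have Q_le: "x \<bullet> (Q *v x) \<le> real (omega_coord A) * (x \<bullet> x)" for x
    using coord_le [of UNIV "omega_coord A" x]
    by (simp add: quad omega_coord_def power2_norm_vec [symmetric] power2_norm_eq_inner)
  have B_le: "x \<bullet> (B *v x) \<le> real s * (x \<bullet> x)" for x
  proof -
    have "x \<bullet> (B *v x) \<le> (\<Sum>l\<in>{1..c}. real s * (\<Sum>j\<in>P l. (x $ j)\<^sup>2))"
      unfolding block_quad
    proof (intro sum_mono coord_le)
      fix l r assume "l \<in> {1..c}"
      then show "card {j \<in> P l. A $ r $ j \<noteq> 0} \<le> s"
        using card_mono [of "P l" "{j \<in> P l. A $ r $ j \<noteq> 0}"] by (auto simp: block_card)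
    qed
    also have "(\<Sum>l\<in>{1..c}. real s * (\<Sum>j\<in>P l. (x $ j)\<^sup>2)) = real s * (\<Sum>j\<in>(\<Union>l\<in>{1..c}. P l). (x $ j)\<^sup>2)"
      using disj
      by (subst sum.UNION_disjoint) (auto simp: disjoint_family_on_def sum_distrib_left)
    finally show ?thesis
      by (simp only: cover power2_norm_vec [symmetric] power2_norm_eq_inner)
  qed

  have Q_pos: "x \<bullet> (Q *v x) > 0" if "x \<noteq> 0" for x
  proof -
    \<comment> \<open>The substitution undoes the normalisation: \<open>C *v x = A *v y\<close>, so
      positive definiteness passes from \<open>M\<close> to \<open>Q\<close>.\<close>
    define y where "y = diagonal_powr (diagonal_part M) (- 1 / 2) *v x"
    have "y $ j = (M $ j $ j) powr (- 1 / 2) * x $ j" for j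
      by (simp add: y_def matrix_vector_mult_def diagonal_powr_def diagonal_part_def
          if_distrib [of "\<lambda>a. a * _"] cong: if_cong)
    then have "y \<noteq> 0"
      using that M_pos by (simp add: vec_eq_iff) (metis less_irrefl)
    moreover have "x \<bullet> (Q *v x) = y \<bullet> (M *v y)"
      unfolding quad M inner_gram_matrix by (simp add: C_def y_def matrix_vector_mul_assoc)
    ultimately show ?thesis using pd by (simp add: positive_definite_def)
  qed
  have B_pos: "x \<bullet> (B *v x) > 0" if "x \<noteq> 0" for x
  proof -
    have "x \<bullet> (B *v x) \<ge> 0" unfolding block_quad by (simp add: sum_nonneg)
    \<comment> \<open>If this value were 0, \<open>block_le\<close> would force the positive number
      \<open>x \<bullet> (Q *v x)\<close> to be at most 0.\<close>
    moreover have "x \<bullet> (B *v x) \<noteq> 0" using block_le [of x] Q_pos [OF that] by auto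
    ultimately show ?thesis by simp
  qed

  \<comment> \<open>Comparison of the maxima\<close>
  obtain x where x: "x \<bullet> (B *v x) \<le> 1" "x \<bullet> (Q *v x) = sigma_block c P Q"
    and block_max: "\<And>y. y \<bullet> (Q *v y) \<le> sigma_block c P Q * (y \<bullet> (B *v y))"
    using Greatest_quadratic_form [of B Q] B_pos unfolding sigma_block_def B_def by blast
  obtain z where z: "z \<bullet> z \<le> 1" "z \<bullet> (Q *v z) = sigma_coord Q"
    and coord_max: "\<And>y. y \<bullet> (Q *v y) \<le> sigma_coord Q * (y \<bullet> y)"
    using Greatest_quadratic_form [of "mat 1" Q] unfolding sigma_coord_def by auto
  \<comment> \<open>The index \<open>undefined\<close> stands for an arbitrary coordinate: every
    diagonal entry of \<open>Q\<close> is 1, and \<open>B\<close> shares its diagonal because the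
    blocks cover all indices.\<close>
  define e :: "real ^ 'd" where "e = axis undefined 1"
  have e_Q: "e \<bullet> (Q *v e) = 1"
    unfolding quad by (simp add: e_def matrix_vector_mult_basis unit)
  have e_B: "e \<bullet> (B *v e) = 1"
  proof -
    obtain l where "l \<in> {1..c}" "undefined \<in> P l" using cover by blast
    then have "B $ undefined $ undefined = Q $ undefined $ undefined"
      by (auto simp: B_def block_diagonal_def)
    then show ?thesis
      using e_Q by (simp add: e_def matrix_vector_mult_basis inner_axis' column_def)
  qed
  have e_e: "e \<bullet> e = 1" by (simp add: e_def inner_axis_axis)
  have one_le: "1 \<le> sigma_block c P Q" "1 \<le> sigma_coord Q"
    using block_max [of e] coord_max [of e] by (simp_all add: e_Q e_B e_e)
  have "z \<bullet> (B *v z) \<le> real s"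
    using B_le [of z] mult_left_mono [OF z(1), of "real s"] by simp
  \<comment> \<open>The maximiser \<open>z\<close> for \<sigma> is tested in the homogeneous
    inequality for \<sigma>'. Enlarging \<open>z \<bullet> (B *v z)\<close> to \<open>s\<close> is
    allowed since \<sigma>' is nonnegative, being at least 1.\<close>
  then have "sigma_coord Q \<le> sigma_block c P Q * real s"
    using block_max [of z] z(2) one_le(1) mult_left_mono [of "z \<bullet> (B *v z)" "real s" "sigma_block c P Q"]
    by linarith
  then have "sigma_coord Q / real s \<le> sigma_block c P Q"
    using s_pos by (simp add: divide_le_eq)
  moreover have "sigma_block c P Q \<le> real (omega_block c P A)"
    using block_le [of x] x mult_left_mono [OF x(1), of "real (omega_block c P A)"] by simp
  moreover have "sigma_coord Q \<le> real (omega_coord A)"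
    using Q_le [of z] z mult_left_mono [OF z(1), of "real (omega_coord A)"] by simp
  moreover have "omega_block c P A \<le> c"
  proof -
    have "card {l \<in> {1..c}. row r (column_submatrix A (P l)) \<noteq> 0} \<le> c" for r
      by (rule order_trans [OF card_mono [of "{1..c}"]]) auto
    then show ?thesis by (auto simp: omega_block_def)
  qed
  moreover have "omega_coord A \<le> CARD('d)"
    by (simp add: omega_coord_def card_mono)
  ultimately show ?thesis using one_le by simp
qed

end
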